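(* Let $m, n \in \mathbb{N}$ be positive integers. Let $\mathcal{A}$ be an $m$th-order $n$-dimensional strong Hankel tensor generated by an absolutely integrable real valued nonnegative function. If the order $m$ is an even number, then $\mathcal{A}$ is a completely decomposable tensor and a limiting point of complete Hankel tensors (i.e. the limit of a sequence of $m$th-order $n$-dimensional complete Hankel tensors). If the order $m$ is an odd number, then $\mathcal{A}$ is a completely $r$-decomposable tensor with $r = (n-1)m+1$, i.e. there are vectors $\mathbf{x}_1, \ldots, \mathbf{x}_r \in \mathbb{R}^n$ with $\mathcal{A} = \sum_{j=1}^r \mathbf{x}_j^{\otimes m}$.
   Context: For $\mathbf{x}\in\mathbb{R}^n$, $\mathbf{x}^{\otimes m}$ is the symmetric tensor with entries $x_{i_1}\cdots x_{i_m}$. A Hankel tensor of order $m$ and dimension $n$ with generating vector $\mathbf{v}=(v_0,\ldots,v_{(n-1)m})^\top$ is the real symmetric tensor $\mathcal{A}=(a_{i_1\cdots i_m})$ with $a_{i_1\cdots i_m}=v_{i_1+\cdots+i_m-m}$ for $i_1,\ldots,i_m\in\{1,\ldots,n\}$. $\mathcal{A}$ is called a strong Hankel tensor generated by an absolutely integrable real valued nonnegative function $h:(-\infty,+\infty)\to[0,+\infty)$ if it is a Hankel tensor whose generating vector satisfies $v_k=\int_{-\infty}^{\infty}t^k h(t)\,dt$ for $k=0,1,\ldots,(n-1)m$ (all these integrals being assumed to exist and be finite). A real symmetric tensor $\mathcal{A}$ of order $m$ and dimension $n$ is completely decomposable if there are a positive integer $r$ and vectors $\mathbf{x}_1,\ldots,\mathbf{x}_r\in\mathbb{R}^n$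 with $\mathcal{A}=\sum_{j=1}^r\mathbf{x}_j^{\otimes m}$. A complete Hankel tensor is a tensor of the form $\sum_{i=1}^r\alpha_i\mathbf{u}_i^{\otimes m}$ with $r$ a positive integer, all $\alpha_i\ge 0$, and each $\mathbf{u}_i$ a Vandermonde vector, i.e. $\mathbf{u}_i=(1,\gamma_i,\gamma_i^2,\ldots,\gamma_i^{n-1})^\top$ for some $\gamma_i\in\mathbb{R}$. Convergence of tensors is entrywise. *)

theory Defs
  imports "HOL-Analysis.Analysis"
begin

text \<open>
  Indices are 1-based. A vector in \<open>\<real>\<^sup>n\<close> is a function \<open>nat \<Rightarrow> real\<close> of which only the components
  \<open>1, \<dots>, n\<close> are ever used. A tensor of order \<open>m\<close> and dimension \<open>n\<close> is a function on multi-indices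
  that is extensional (\<open>undefined\<close> outside of \<open>multi_indices m n\<close>), so that equality of functions is
  equality of tensors.
\<close>

definition multi_indices :: "nat \<Rightarrow> nat \<Rightarrow> nat list set" where
  "multi_indices m n = {I. length I = m \<and> set I \<subseteq> {1..n}}"

definition symmetric_tensors :: "nat \<Rightarrow> nat \<Rightarrow> (nat list \<Rightarrow> real) set" where
  "symmetric_tensors m n = {A \<in> multi_indices m n \<rightarrow>\<^sub>E UNIV.
     \<forall>I\<in>multi_indices m n. \<forall>J\<in>multi_indices m n. mset I = mset J \<longrightarrow> A I = A J}"

definition tensor_power :: "nat \<Rightarrow> nat \<Rightarrow> (nat \<Rightarrow> real) \<Rightarrow> nat list \<Rightarrow> real" where
  "tensor_power m n x = (\<lambda>I\<in>multi_indices m n. prod_list (map x I))"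

text \<open>The subtraction does not truncate: all indices are at least 1.\<close>

definition hankel_tensor :: "nat \<Rightarrow> nat \<Rightarrow> (nat \<Rightarrow> real) \<Rightarrow> nat list \<Rightarrow> real" where
  "hankel_tensor m n v = (\<lambda>I\<in>multi_indices m n. v (sum_list I - m))"

definition strong_hankel_tensor ::
    "nat \<Rightarrow> nat \<Rightarrow> (real \<Rightarrow> real) \<Rightarrow> (nat list \<Rightarrow> real) \<Rightarrow> bool" where
  "strong_hankel_tensor m n h A \<longleftrightarrow>
     (\<forall>t. 0 \<le> h t) \<and> integrable lebesgue h \<and>
     (\<exists>v. A = hankel_tensor m n v \<and>
        (\<forall>k\<in>{0..(n - 1) * m}.
           integrable lebesgue (\<lambda>t. t ^ k * h t) \<and>
           v k = integral\<^sup>L lebesgue (\<lambda>t. t ^ k * h t)))"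

definition completely_r_decomposable ::
    "nat \<Rightarrow> nat \<Rightarrow> nat \<Rightarrow> (nat list \<Rightarrow> real) \<Rightarrow> bool" where
  "completely_r_decomposable m n r A \<longleftrightarrow>
     A \<in> symmetric_tensors m n \<and>
     (\<exists>x :: nat \<Rightarrow> nat \<Rightarrow> real.
        A = (\<lambda>I\<in>multi_indices m n. \<Sum>j=1..r. tensor_power m n (x j) I))"

definition completely_decomposable :: "nat \<Rightarrow> nat \<Rightarrow> (nat list \<Rightarrow> real) \<Rightarrow> bool" where
  "completely_decomposable m n A \<longleftrightarrow> (\<exists>r\<ge>1. completely_r_decomposable m n r A)"

definition vandermonde_vector :: "nat \<Rightarrow> (nat \<Rightarrow> real) \<Rightarrow> bool" where
  "vandermonde_vector n u \<longleftrightarrow> (\<exists>\<gamma>. \<forall>i\<in>{1..n}. u i = \<gamma> ^ (i - 1))"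

definition complete_hankel_tensor :: "nat \<Rightarrow> nat \<Rightarrow> (nat list \<Rightarrow> real) \<Rightarrow> bool" where
  "complete_hankel_tensor m n A \<longleftrightarrow>
     (\<exists>r\<ge>1. \<exists>(\<alpha> :: nat \<Rightarrow> real) (u :: nat \<Rightarrow> nat \<Rightarrow> real).
        (\<forall>i\<in>{1..r}. 0 \<le> \<alpha> i \<and> vandermonde_vector n (u i)) \<and>
        A = (\<lambda>I\<in>multi_indices m n. \<Sum>i=1..r. \<alpha> i * tensor_power m n (u i) I))"

definition tensor_tendsto ::
    "nat \<Rightarrow> nat \<Rightarrow> (nat \<Rightarrow> nat list \<Rightarrow> real) \<Rightarrow> (nat list \<Rightarrow> real) \<Rightarrow> bool" where
  "tensor_tendsto m n B A \<longleftrightarrow>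
     (\<forall>I\<in>multi_indices m n. (\<lambda>k. B k I) \<longlonglongrightarrow> A I)"

end

theory Submission
  imports Defs "HOL-Computational_Algebra.Fundamental_Theorem_Algebra"
begin

text \<open>
  A strong Hankel tensor is itself a complete Hankel tensor, so that the constant sequence is a
  sequence of complete Hankel tensors converging to it. The reason is Gauss quadrature.
  Put \<open>N = (n - 1) * m\<close>. Only the moments \<open>v\<^sub>0, \<dots>, v\<^sub>N\<close> of \<open>h\<close> enter the tensor, and they
  are also the moments of a nonnegative measure with at most \<open>N + 1\<close> atoms,
  \<open>v\<^sub>k = (\<Sum>j. \<alpha>\<^sub>j * \<gamma>\<^sub>j ^ k)\<close>. Since an entry of the tensor power of a Vandermonde vector is
  \<open>\<gamma> ^ (i\<^sub>1 + \<dots> + i\<^sub>m - m)\<close>, this says exactly that the tensor is the sum of the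
  \<open>\<alpha>\<^sub>j u\<^sub>j\<^bsup>\<otimes>m\<^esup>\<close>, where \<open>u\<^sub>j\<close> is the Vandermonde vector of \<open>\<gamma>\<^sub>j\<close>. As \<open>\<alpha>\<^sub>j \<ge> 0\<close>, the weight can be
  absorbed, \<open>\<alpha>\<^sub>j u\<^sub>j\<^bsup>\<otimes>m\<^esup> = (root m \<alpha>\<^sub>j u\<^sub>j)\<^bsup>\<otimes>m\<^esup>\<close>, for even and odd \<open>m\<close> alike.

  For the atoms, let \<open>L\<close> be a linear functional on polynomials whose value at \<open>p\<close> is the
  integral of \<open>p * h\<close> if \<open>p\<close> has degree at most \<open>N\<close>. Unless \<open>h\<close> vanishes almost everywhere,
  \<open>L (p * p) > 0\<close> for all nonzero \<open>p\<close> of degree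
  at most \<open>d = N div 2\<close>, so there is a polynomial \<open>P\<close> of degree \<open>d + 1\<close> that is
  orthogonal to all polynomials of degree at most \<open>d\<close> (\<open>orthogonal_polynomial\<close>). It has \<open>d + 1\<close>
  distinct real roots: otherwise \<open>P = g * Q\<close> with \<open>g = (X - a)\<^sup>2 + b\<^sup>2\<close>, where \<open>b = 0\<close> stands for a
  multiple root and \<open>b \<noteq> 0\<close> for a pair of conjugate roots, and then \<open>L (P * Q) = L (g * Q\<^sup>2) > 0\<close>
  although \<open>Q\<close> has degree \<open>d - 1\<close>. Division by \<open>P\<close> and Lagrange interpolation at the
  roots give the quadrature formula for all degrees up to \<open>2 * d + 1 \<ge> N\<close>, and evaluating it at
  the squares of the Lagrange polynomials shows that its weights are positive
  (\<open>Gauss_quadrature\<close>).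
\<close>

section \<open>Orthogonal polynomials of a positive functional\<close>

text \<open>
  Positivity is required on squares of degree at most \<open>2 * d\<close> only, because this is all that
  finitely many moments of a measure can guarantee.
\<close>

locale positive_functional =
  fixes L :: "real poly \<Rightarrow> real" and d :: nat
  assumes L_add: "L (p + q) = L p + L q"
    and L_smult: "L (smult c p) = c * L p"
    and L_square_pos: "p \<noteq> 0 \<Longrightarrow> degree p \<le> d \<Longrightarrow> 0 < L (p * p)"
begin

lemma L_0: "L 0 = 0"
  using L_smult[of 0 0] by simp

lemma L_diff: "L (p - q) = L p - L q"
  using L_add[of "p - q" q] by simp

lemma L_sum: "L (\<Sum>x\<in>S. f x) = (\<Sum>x\<in>S. L (f x))"
  by (induction S rule: infinite_finite_induct) (auto simp: L_0 L_add)

text \<open>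
  Gram-Schmidt: \<open>r\<close> is the orthogonal projection of \<open>f\<close> to the polynomials of degree less than \<open>k\<close>.
  The condition on \<open>r\<close> is put on coefficients so that it forces \<open>r = 0\<close> for \<open>k = 0\<close>. The polynomial
  \<open>f\<close> may have any degree, which the step from \<open>k\<close> to \<open>k + 1\<close> exploits: it also projects \<open>X\<^sup>k\<close> to
  obtain the next orthogonal polynomial \<open>e\<close>.
\<close>

lemma orthogonal_projection:
  assumes "k \<le> Suc d"
  shows "\<exists>r. (\<forall>i\<ge>k. coeff r i = 0) \<and> (\<forall>q. degree q < k \<longrightarrow> L ((f - r) * q) = 0)"
  using assms
proof (induction k arbitrary: f)
  case 0
  show ?case by (intro exI[of _ 0]) auto
next
  case (Suc k)
  obtain s where s: "\<forall>i\<ge>k. coeff s i = 0" "\<And>q. degree q < k \<Longrightarrow> L ((monom 1 k - s) * q) = 0"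
    using Suc.IH[of "monom 1 k"] Suc.prems by auto
  obtain r where r: "\<forall>i\<ge>k. coeff r i = 0" "\<And>q. degree q < k \<Longrightarrow> L ((f - r) * q) = 0"
    using Suc.IH[of f] Suc.prems by auto
  define e where "e = monom 1 k - s"
  have e_k: "coeff e k = 1" and e_high: "\<And>i. i > k \<Longrightarrow> coeff e i = 0"
    using s(1) by (auto simp: e_def)
  have e_deg: "degree e \<le> k" using e_high by (intro degree_le) auto
  have "e \<noteq> 0" using e_k by auto
  hence e_pos: "0 < L (e * e)" using L_square_pos e_deg Suc.prems by simp
  define c where "c = L ((f - r) * e) / L (e * e)"
  have "L ((f - (r + smult c e)) * q) = 0" if q: "degree q < Suc k" for q
  proof -
    \<comment> \<open>Removing the multiple of \<open>e\<close> leaves a polynomial of degree less than \<open>k\<close>, to which the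
      induction hypotheses for \<open>f\<close> and for \<open>X\<^sup>k\<close> apply.\<close>
    define q' where "q' = q - smult (coeff q k) e"
    have q'0: "coeff q' i = 0" if "i \<ge> k" for i
      using that q e_k e_high by (cases "i = k") (auto simp: q'_def coeff_eq_0)
    have orth: "L (g * q') = 0" if "\<And>q. degree q < k \<Longrightarrow> L (g * q) = 0" for g
    proof (cases "q' = 0")
      case False
      have "degree q' < k"
        using q'0 leading_coeff_neq_0[OF False] by (meson not_le)
      thus ?thesis using that by simp
    qed (simp add: L_0)
    have 1: "L ((f - r) * q') = 0" using orth r(2) by blast
    have 2: "L (e * q') = 0" using orth s(2) unfolding e_def by blast
    have "(f - (r + smult c e)) * q
        = smult (coeff q k) ((f - r) * e) - smult (coeff q k * c) (e * e)
          + ((f - r) * q' - smult c (e * q'))"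
      by (simp add: q'_def algebra_simps smult_add_right smult_diff_right)
    hence "L ((f - (r + smult c e)) * q) = coeff q k * L ((f - r) * e) - coeff q k * c * L (e * e)"
      by (simp add: L_add L_diff L_smult 1 2)
    also have "\<dots> = 0" using e_pos by (simp add: c_def)
    finally show ?thesis .
  qed
  moreover have "\<forall>i\<ge>Suc k. coeff (r + smult c e) i = 0"
    using r(1) e_high by auto
  ultimately show ?case by blast
qed

lemma orthogonal_polynomial:
  obtains P where "degree P = Suc d" "\<And>q. degree q \<le> d \<Longrightarrow> L (P * q) = 0"
proof -
  obtain r where r: "\<forall>i\<ge>Suc d. coeff r i = 0"
      "\<forall>q. degree q < Suc d \<longrightarrow> L ((monom 1 (Suc d) - r) * q) = 0"
    using orthogonal_projection[of "Suc d" "monom 1 (Suc d)"] by auto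
  have "degree (monom 1 (Suc d) - r) \<le> Suc d"
    using r(1) by (intro degree_le) auto
  moreover have "coeff (monom 1 (Suc d) - r) (Suc d) \<noteq> 0" using r(1) by simp
  ultimately have "degree (monom 1 (Suc d) - r) = Suc d"
    using le_degree le_antisym by blast
  thus thesis using that r(2) by auto
qed

text \<open>
  The cofactor \<open>Q\<close> has degree \<open>d - 1\<close>, so \<open>P\<close> is orthogonal to it; but \<open>P * Q\<close> is the sum of the
  squares of \<open>(X - a) * Q\<close> and \<open>b * Q\<close>, and \<open>L\<close> is positive on the first because \<open>(X - a) * Q\<close> is
  nonzero of degree \<open>d\<close>.
\<close>

lemma no_nonneg_quadratic_factor:
  assumes deg: "degree P = Suc d" and orth: "\<And>q. degree q \<le> d \<Longrightarrow> L (P * q) = 0"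
  shows "\<not> ([:-a, 1:] * [:-a, 1:] + [:b * b:]) dvd P"
proof
  assume "([:-a, 1:] * [:-a, 1:] + [:b * b:]) dvd P"
  then obtain Q where Q: "P = ([:-a, 1:] * [:-a, 1:] + [:b * b:]) * Q" by (auto simp: dvd_def)
  have "P \<noteq> 0" using deg by auto
  hence "Q \<noteq> 0" using Q by auto
  have "degree ([:-a, 1:] * [:-a, 1:] + [:b * b:]) = 2" by simp
  hence "Suc d = 2 + degree Q"
    using deg Q \<open>P \<noteq> 0\<close> by (metis degree_mult_eq mult_zero_left \<open>Q \<noteq> 0\<close>)
  hence dQ: "degree ([:-a, 1:] * Q) \<le> d" "degree Q \<le> d"
    using \<open>Q \<noteq> 0\<close> by (auto simp: degree_mult_eq simp del: mult_pCons_left)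
  have "(M * M + [:c:]) * Q * Q = (M * Q) * (M * Q) + smult c (Q * Q)" for M c
    by (simp add: algebra_simps)
  hence "P * Q = ([:-a, 1:] * Q) * ([:-a, 1:] * Q) + smult (b * b) (Q * Q)"
    unfolding Q by blast
  hence "L (P * Q) = L (([:-a, 1:] * Q) * ([:-a, 1:] * Q)) + b * b * L (Q * Q)"
    by (simp only: L_add L_smult)
  moreover have "L (([:-a, 1:] * Q) * ([:-a, 1:] * Q)) > 0"
    using dQ \<open>Q \<noteq> 0\<close> by (intro L_square_pos) (auto simp del: mult_pCons_left)
  moreover have "L (Q * Q) > 0" using dQ \<open>Q \<noteq> 0\<close> by (intro L_square_pos)
  ultimately show False using orth[OF dQ(2)]
    by (smt (verit) mult_nonneg_nonneg zero_le_square)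
qed

end

section \<open>Real roots and interpolation\<close>

lemma map_poly_of_real_add:
  "map_poly of_real (p + q) = (map_poly of_real p + map_poly of_real q :: complex poly)"
  by (intro poly_eqI) (simp add: coeff_map_poly)

lemma map_poly_of_real_mult:
  "map_poly of_real (p * q) = (map_poly of_real p * map_poly of_real q :: complex poly)"
  by (intro poly_eqI) (simp add: coeff_map_poly coeff_mult)

lemma poly_map_poly_of_real:
  "poly (map_poly of_real p) (of_real a) = complex_of_real (poly p a)"
  by (induction p) (auto simp: map_poly_pCons)

text \<open>
  The remainder of \<open>P\<close> modulo the quadratic polynomial with roots \<open>z\<close> and \<open>cnj z\<close> is a real
  polynomial of degree at most one that vanishes at \<open>z\<close>, hence zero.
\<close>

lemma nonreal_root_imp_quadratic_factor:
  fixes P :: "real poly"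
  assumes "poly (map_poly of_real P) z = 0" "Im z \<noteq> 0"
  shows "([:- Re z, 1:] * [:- Re z, 1:] + [:Im z * Im z:]) dvd P"
proof -
  define g where "g = [:- Re z, 1:] * [:- Re z, 1:] + [:Im z * Im z:]"
  define r where "r = P mod g"
  have g: "degree g = 2" by (simp add: g_def)
  hence "g \<noteq> 0" by auto
  hence "r = 0 \<or> degree r < 2" using degree_mod_less[of g P] g unfolding r_def by auto
  hence "degree r \<le> 1" by auto
  define u v where "u = coeff r 0" and "v = coeff r 1"
  have r: "r = [:u, v:]"
    using \<open>degree r \<le> 1\<close> unfolding u_def v_def
    by (intro poly_eqI) (auto simp: coeff_pCons coeff_eq_0 split: nat.splits)
  have g0: "poly (map_poly of_real g) z = 0"
    by (simp add: g_def map_poly_pCons complex_eq_iff algebra_simps)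
  have "P = P div g * g + r" by (simp add: r_def)
  hence "poly (map_poly of_real P) z = poly (map_poly of_real (P div g * g + r)) z"
    by (rule arg_cong)
  also have "\<dots> = poly (map_poly of_real r) z"
    by (simp add: map_poly_of_real_add map_poly_of_real_mult g0)
  finally have "complex_of_real u + z * of_real v = 0"
    using assms(1) r by (simp add: map_poly_pCons)
  hence "u = 0 \<and> v = 0" using assms(2) by (auto simp: complex_eq_iff)
  hence "P mod g = 0" using r r_def by simp
  thus ?thesis unfolding g_def by (simp add: mod_eq_0_iff_dvd)
qed

lemma prod_linear_factors_dvd:
  fixes P :: "real poly"
  assumes "finite Z" "\<And>x. x \<in> Z \<Longrightarrow> poly P x = 0"
  shows "(\<Prod>x\<in>Z. [:-x, 1:]) dvd P"
  using assms
proof (induction Z)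
  case (insert x Z)
  then obtain Q where Q: "P = (\<Prod>x\<in>Z. [:-x, 1:]) * Q" by (auto simp: dvd_def)
  have "poly (\<Prod>x\<in>Z. [:-x, 1:]) x \<noteq> 0"
    using insert.hyps by (auto simp: poly_prod)
  hence "poly Q x = 0" using insert.prems[of x] Q by simp
  hence "[:-x, 1:] dvd Q" by (simp add: poly_eq_0_iff_dvd)
  thus ?case using insert.hyps Q by (auto simp: mult.commute
        simp del: mult_pCons_left mult_pCons_right intro!: mult_dvd_mono)
qed simp

text \<open>
  Split off one linear factor for every real root. If the cofactor \<open>Q\<close> is not constant, it has a
  complex root. A nonreal root yields a quadratic factor with \<open>b \<noteq> 0\<close>; a real root of \<open>Q\<close> is a
  multiple root of \<open>P\<close> and yields one with \<open>b = 0\<close>.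
\<close>

lemma distinct_real_roots_or_quadratic_factor:
  fixes P :: "real poly"
  assumes "P \<noteq> 0"
  shows "card {x. poly P x = 0} = degree P
       \<or> (\<exists>a b. ([:-a, 1:] * [:-a, 1:] + [:b * b:]) dvd P)"
proof -
  define Z where "Z = {x. poly P x = 0}"
  define W where "W = (\<Prod>x\<in>Z. [:-x, 1:])"
  have fin: "finite Z" using assms by (simp add: Z_def poly_roots_finite)
  have "W dvd P" unfolding W_def by (rule prod_linear_factors_dvd[OF fin]) (simp add: Z_def)
  then obtain Q where Q: "P = W * Q" by (auto simp: dvd_def)
  have "degree W = card Z" unfolding W_def by (subst degree_prod_eq_sum_degree) auto
  moreover have "degree P = degree W + degree Q" using assms Q by (auto simp: degree_mult_eq)
  ultimately have deg: "degree P = card Z + degree Q" by simp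
  show ?thesis
  proof (cases "degree Q = 0")
    case True
    thus ?thesis using deg by (simp add: Z_def)
  next
    case False
    have "degree (map_poly complex_of_real Q) = degree Q"
      by (rule degree_map_poly) auto
    hence "\<not> constant (poly (map_poly complex_of_real Q))"
      using False by (simp add: constant_degree)
    then obtain z where z: "poly (map_poly complex_of_real Q) z = 0"
      using fundamental_theorem_of_algebra by blast
    show ?thesis
    proof (cases "Im z = 0")
      case False
      have "poly (map_poly complex_of_real P) z = 0" by (simp add: Q map_poly_of_real_mult z)
      thus ?thesis using nonreal_root_imp_quadratic_factor False by blast
    next
      case True
      define a where "a = Re z"
      have za: "z = of_real a" using True by (simp add: a_def complex_eq_iff)
      have "poly Q a = 0" using z unfolding za poly_map_poly_of_real by simp
      hence "a \<in> Z" by (simp add: Z_def Q)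
      hence "[:-a, 1:] dvd W" unfolding W_def using fin by (intro dvd_prodI)
      hence "[:-a, 1:] * [:-a, 1:] dvd P"
        unfolding Q using \<open>poly Q a = 0\<close> by (intro mult_dvd_mono) (auto simp: poly_eq_0_iff_dvd)
      thus ?thesis by (intro disjI2 exI[of _ a] exI[of _ 0]) simp
    qed
  qed
qed

definition Lagrange_basis :: "real set \<Rightarrow> real \<Rightarrow> real poly" where
  "Lagrange_basis Z x = smult (1 / (\<Prod>y\<in>Z - {x}. x - y)) (\<Prod>y\<in>Z - {x}. [:-y, 1:])"

lemma poly_Lagrange_basis:
  assumes "finite Z" "y \<in> Z"
  shows "poly (Lagrange_basis Z x) y = (if x = y then 1 else 0)"
  using assms by (auto simp: Lagrange_basis_def poly_prod)

lemma degree_Lagrange_basis: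
  assumes "finite Z" "x \<in> Z"
  shows "degree (Lagrange_basis Z x) < card Z"
proof -
  have "degree (Lagrange_basis Z x) \<le> card (Z - {x})"
    unfolding Lagrange_basis_def
    by (rule order.trans[OF degree_smult_le]) (subst degree_prod_eq_sum_degree, auto)
  thus ?thesis using assms by (metis card_Diff1_less le_less_trans)
qed

lemma Lagrange_interpolation:
  assumes "finite Z" "degree p < card Z"
  shows "p = (\<Sum>x\<in>Z. smult (poly p x) (Lagrange_basis Z x))"
proof (rule poly_eqI_degree[where A = Z])
  fix y assume "y \<in> Z"
  have "poly (\<Sum>x\<in>Z. smult (poly p x) (Lagrange_basis Z x)) y
      = (\<Sum>x\<in>Z. if x = y then poly p x else 0)"
    unfolding poly_sum
    using assms \<open>y \<in> Z\<close> by (intro sum.cong) (auto simp: poly_Lagrange_basis)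
  thus "poly p y = poly (\<Sum>x\<in>Z. smult (poly p x) (Lagrange_basis Z x)) y"
    using assms \<open>y \<in> Z\<close> by simp
next
  have "degree (\<Sum>x\<in>Z. smult (poly p x) (Lagrange_basis Z x)) \<le> card Z - 1"
    using degree_Lagrange_basis[OF assms(1)]
    by (intro degree_sum_le assms order.trans[OF degree_smult_le]) fastforce
  thus "degree (\<Sum>x\<in>Z. smult (poly p x) (Lagrange_basis Z x)) < card Z"
    using assms(2) by linarith
qed (use assms in auto)

section \<open>Gauss quadrature\<close>

context positive_functional
begin

text \<open>
  The nodes are the roots of the orthogonal polynomial \<open>P\<close>, and the weights are the values of \<open>L\<close> on
  the Lagrange polynomials. Writing \<open>p = P * s + r\<close>, the first summand is annihilated by \<open>L\<close> and
  vanishes at the nodes, and \<open>r\<close> is recovered from its values at the nodes. This reaches degree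
  \<open>2 * d + 1\<close> because \<open>s\<close> then still has degree at most \<open>d\<close>.
\<close>

theorem Gauss_quadrature:
  obtains Z w where "finite Z" "card Z = Suc d" "\<And>x. x \<in> Z \<Longrightarrow> 0 < w x"
    "\<And>p. degree p \<le> 2 * d + 1 \<Longrightarrow> L p = (\<Sum>x\<in>Z. w x * poly p x)"
proof -
  obtain P where deg: "degree P = Suc d" and orth: "\<And>q. degree q \<le> d \<Longrightarrow> L (P * q) = 0"
    using orthogonal_polynomial by blast
  hence "P \<noteq> 0" by auto
  define Z where "Z = {x. poly P x = 0}"
  define w where "w x = L (Lagrange_basis Z x)" for x
  have fin: "finite Z" unfolding Z_def using \<open>P \<noteq> 0\<close> by (rule poly_roots_finite)
  have card: "card Z = Suc d"
    using distinct_real_roots_or_quadratic_factor[OF \<open>P \<noteq> 0\<close>]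
      no_nonneg_quadratic_factor[OF deg orth] deg by (auto simp: Z_def)
  have quadrature: "L p = (\<Sum>x\<in>Z. w x * poly p x)" if p: "degree p \<le> 2 * d + 1" for p
  proof -
    define s where "s = p div P"
    define r where "r = p mod P"
    have pr: "p = P * s + r" by (simp add: s_def r_def)
    have "r = 0 \<or> degree r < Suc d"
      using degree_mod_less[OF \<open>P \<noteq> 0\<close>, of p] deg by (simp add: r_def)
    hence dr: "degree r < Suc d" by auto
    have "P * s = p - r" using pr by simp
    hence "degree (P * s) \<le> 2 * d + 1" using degree_diff_le[OF p, of r] dr by simp
    hence "degree s \<le> d"
      using deg degree_mult_eq[OF \<open>P \<noteq> 0\<close>, of s] by (cases "s = 0") auto
    hence "L p = L r" using orth by (simp add: pr L_add)
    have "degree r < card Z" using dr card by simp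
    hence "L r = L (\<Sum>x\<in>Z. smult (poly r x) (Lagrange_basis Z x))"
      using Lagrange_interpolation[OF fin] by metis
    also have "\<dots> = (\<Sum>x\<in>Z. w x * poly r x)"
      by (simp add: L_sum L_smult w_def mult.commute)
    also have "\<dots> = (\<Sum>x\<in>Z. w x * poly p x)"
      by (intro sum.cong) (auto simp: pr Z_def)
    finally show ?thesis using \<open>L p = L r\<close> by simp
  qed
  have "0 < w x" if x: "x \<in> Z" for x
  proof -
    \<comment> \<open>The square of the Lagrange polynomial is 1 at \<open>x\<close> and 0 at the other nodes, and its
      degree \<open>2 * d\<close> is within reach of the formula.\<close>
    let ?l = "Lagrange_basis Z x"
    have dl: "degree ?l \<le> d" using degree_Lagrange_basis[OF fin x] card by simp
    have "poly ?l x = 1" using poly_Lagrange_basis[OF fin x] by simp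
    hence "?l \<noteq> 0" by auto
    have "w x = (\<Sum>y\<in>Z. if y = x then w y else 0)" using fin x by simp
    also have "\<dots> = (\<Sum>y\<in>Z. w y * poly (?l * ?l) y)"
      using fin by (intro sum.cong) (auto simp: poly_Lagrange_basis)
    also have "\<dots> = L (?l * ?l)"
      using dl degree_mult_le[of ?l ?l] by (intro quadrature[symmetric]) linarith
    finally show ?thesis using L_square_pos[OF \<open>?l \<noteq> 0\<close> dl] by simp
  qed
  thus thesis using that fin card quadrature by blast
qed

end

section \<open>Moments of a nonnegative function\<close>

definition moment_functional :: "(nat \<Rightarrow> real) \<Rightarrow> real poly \<Rightarrow> real" where
  "moment_functional v p = (\<Sum>i\<le>degree p. coeff p i * v i)"

text \<open>
  A common summation range for polynomials of different degrees makes linearity evident.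
\<close>

lemma moment_functional_eq:
  assumes "degree p \<le> M"
  shows "moment_functional v p = (\<Sum>i\<le>M. coeff p i * v i)"
  unfolding moment_functional_def using assms
  by (intro sum.mono_neutral_left) (auto simp: coeff_eq_0)

lemma moment_functional_add:
  "moment_functional v (p + q) = moment_functional v p + moment_functional v q"
proof -
  let ?M = "max (degree p) (degree q)"
  show ?thesis
    using degree_add_le_max[of p q]
    by (simp add: moment_functional_eq[of _ ?M] algebra_simps sum.distrib)
qed

lemma moment_functional_smult: "moment_functional v (smult c p) = c * moment_functional v p"
  by (simp add: moment_functional_eq[of _ "degree p"] degree_smult_le sum_distrib_left mult.assoc)

lemma moment_functional_monom: "moment_functional v (monom 1 k) = v k"
  by (simp add: moment_functional_eq[of _ k] degree_monom_le if_distrib[of "\<lambda>c. c * _"] cong: if_cong)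

lemma moment_functional_integral:
  assumes "\<And>k. k \<le> N \<Longrightarrow> integrable lebesgue (\<lambda>t. t ^ k * h t)"
    and "\<And>k. k \<le> N \<Longrightarrow> v k = integral\<^sup>L lebesgue (\<lambda>t. t ^ k * h t)"
    and "degree p \<le> N"
  shows "integrable lebesgue (\<lambda>t. poly p t * h t)"
    and "moment_functional v p = integral\<^sup>L lebesgue (\<lambda>t. poly p t * h t)"
proof -
  have eq: "(\<lambda>t. poly p t * h t) = (\<lambda>t. \<Sum>i\<le>degree p. coeff p i * (t ^ i * h t))"
    by (simp add: poly_altdef sum_distrib_right mult.assoc)
  have int: "integrable lebesgue (\<lambda>t. coeff p i * (t ^ i * h t))" if "i \<le> degree p" for i
    using that assms(1,3) by (intro integrable_mult_right) auto
  show "integrable lebesgue (\<lambda>t. poly p t * h t)"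
    unfolding eq using int by (intro Bochner_Integration.integrable_sum) auto
  show "moment_functional v p = integral\<^sup>L lebesgue (\<lambda>t. poly p t * h t)"
    unfolding eq moment_functional_def using int assms(2,3)
    by (subst Bochner_Integration.integral_sum) auto
qed

lemma AE_zero_if_poly_times_zero:
  fixes h :: "real \<Rightarrow> real"
  assumes "p \<noteq> 0" "AE t in lebesgue. poly p t * h t = 0"
  shows "AE t in lebesgue. h t = 0"
proof -
  have "negligible {t. poly p t = 0}"
    using assms(1) by (intro negligible_finite poly_roots_finite)
  hence "AE t in lebesgue. t \<notin> {t. poly p t = 0}"
    unfolding negligible_iff_null_sets by (rule AE_not_in)
  with assms(2) show ?thesis by eventually_elim simp
qed

text \<open>
  Richter-Tchakaloff theorem on the line, with the number of atoms that Gauss quadrature gives.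
  If \<open>h\<close> vanishes almost everywhere, its moment functional is zero rather than positive; then any
  nodes will do, with weight zero.
\<close>

theorem moments_finitely_atomic:
  fixes h :: "real \<Rightarrow> real"
  assumes nonneg: "\<And>t. 0 \<le> h t"
    and int: "\<And>k. k \<le> N \<Longrightarrow> integrable lebesgue (\<lambda>t. t ^ k * h t)"
    and v: "\<And>k. k \<le> N \<Longrightarrow> v k = integral\<^sup>L lebesgue (\<lambda>t. t ^ k * h t)"
  obtains Z w where "finite Z" "card Z = Suc (N div 2)" "\<And>x. x \<in> Z \<Longrightarrow> 0 \<le> w x"
    "\<And>k. k \<le> N \<Longrightarrow> v k = (\<Sum>x\<in>Z. w x * x ^ k)"
proof (cases "AE t in lebesgue. h t = 0")
  case True
  have "v k = 0" if "k \<le> N" for k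
  proof -
    have "AE t in lebesgue. t ^ k * h t = 0" using True by eventually_elim simp
    thus ?thesis using v[OF that] by (simp add: integral_eq_zero_AE)
  qed
  thus thesis
    by (intro that[of "real ` {..N div 2}" "\<lambda>_. 0"]) (auto simp: card_image)
next
  case False
  \<comment> \<open>If \<open>N\<close> is even, quadrature will be exact up to degree \<open>N + 1\<close>. The moment of order \<open>N + 1\<close>
    need not exist, but positivity on squares only concerns degrees up to \<open>N\<close>, so \<open>v (N + 1)\<close>
    may be any number.\<close>
  interpret positive_functional "moment_functional v" "N div 2"
  proof
    fix p :: "real poly" assume p: "p \<noteq> 0" "degree p \<le> N div 2"
    have d: "degree (p * p) \<le> N" using p(2) degree_mult_le[of p p] by linarith
    have I: "integrable lebesgue (\<lambda>t. poly (p * p) t * h t)"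
        "moment_functional v (p * p) = integral\<^sup>L lebesgue (\<lambda>t. poly (p * p) t * h t)"
      using moment_functional_integral[of N h v "p * p"] int v d by blast+
    have nn: "AE t in lebesgue. 0 \<le> poly (p * p) t * h t" using nonneg by simp
    have "\<not> (AE t in lebesgue. poly (p * p) t * h t = 0)"
      using AE_zero_if_poly_times_zero[of "p * p" h] p(1) False by auto
    hence "integral\<^sup>L lebesgue (\<lambda>t. poly (p * p) t * h t) \<noteq> 0"
      by (simp only: integral_nonneg_eq_0_iff_AE[OF I(1) nn] simp_thms)
    thus "0 < moment_functional v (p * p)"
      unfolding I(2) using integral_nonneg_AE[OF nn] by linarith
  qed (simp_all add: moment_functional_add moment_functional_smult)
  obtain Z w where Z: "finite Z" "card Z = Suc (N div 2)" "\<And>x. x \<in> Z \<Longrightarrow> 0 < w x"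
    and q: "\<And>p. degree p \<le> 2 * (N div 2) + 1 \<Longrightarrow>
            moment_functional v p = (\<Sum>x\<in>Z. w x * poly p x)"
    using Gauss_quadrature by blast
  have "v k = (\<Sum>x\<in>Z. w x * x ^ k)" if "k \<le> N" for k
    using q[of "monom 1 k"] that degree_monom_le[of "1::real" k]
    by (simp add: moment_functional_monom poly_monom degree_monom_eq)
  thus thesis using that Z less_imp_le by blast
qed

section \<open>Hankel tensors\<close>

lemma length_le_sum_list:
  fixes I :: "nat list"
  assumes "\<forall>i\<in>set I. 1 \<le> i"
  shows "length I \<le> sum_list I"
  using assms by (induction I) auto

lemma prod_list_geometric:
  fixes c \<gamma> :: real
  assumes "\<forall>i\<in>set I. 1 \<le> i"
  shows "prod_list (map (\<lambda>i. c * \<gamma> ^ (i - 1)) I) = c ^ length I * \<gamma> ^ (sum_list I - length I)"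
  using assms
proof (induction I)
  case (Cons i I)
  have "sum_list (i # I) - length (i # I) = (i - 1) + (sum_list I - length I)"
    using Cons.prems length_le_sum_list[of I] by auto
  hence "\<gamma> ^ (sum_list (i # I) - length (i # I))
      = \<gamma> ^ (i - 1) * \<gamma> ^ (sum_list I - length I)"
    by (simp only: power_add)
  thus ?case using Cons by (auto simp: algebra_simps)
qed simp

text \<open>
  A scaled Vandermonde vector has a Hankel tensor as its power, and the scaling factor enters
  with exponent \<open>m\<close>; this is where a nonnegative weight is traded for its \<open>m\<close>-th root.
\<close>

lemma tensor_power_geometric:
  assumes "I \<in> multi_indices m n"
  shows "tensor_power m n (\<lambda>i. c * \<gamma> ^ (i - 1)) I = c ^ m * \<gamma> ^ (sum_list I - m)"
proof -
  have "\<forall>i\<in>set I. 1 \<le> i" and "length I = m"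
    using assms by (auto simp: multi_indices_def)
  thus ?thesis
    using assms prod_list_geometric[of I c \<gamma>] by (simp add: tensor_power_def)
qed

lemma hankel_index_le:
  assumes "I \<in> multi_indices m n"
  shows "sum_list I - m \<le> (n - 1) * m"
proof -
  have "sum_list I \<le> n * length I" if "set I \<subseteq> {1..n}"
    using that by (induction I) auto
  thus ?thesis using assms by (auto simp: multi_indices_def diff_mult_distrib)
qed

lemma hankel_tensor_symmetric: "hankel_tensor m n v \<in> symmetric_tensors m n"
proof -
  have "sum_list I = sum_list J" if "mset I = mset J" for I J :: "nat list"
    using arg_cong[OF that, of sum_mset] by (simp only: sum_mset_sum_list)
  hence "\<forall>I\<in>multi_indices m n. \<forall>J\<in>multi_indices m n.
      mset I = mset J \<longrightarrow> hankel_tensor m n v I = hankel_tensor m n v J"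
    unfolding hankel_tensor_def by (metis restrict_apply)
  moreover have "hankel_tensor m n v \<in> multi_indices m n \<rightarrow>\<^sub>E UNIV"
    by (simp add: hankel_tensor_def)
  ultimately show ?thesis unfolding symmetric_tensors_def by blast
qed

text \<open>
  The atoms are numbered and padded with terms of weight zero, because quadrature gives only
  \<open>(n - 1) * m div 2 + 1\<close> of them and the decomposition has a prescribed length.
\<close>

lemma strong_hankel_tensor_decomposition:
  assumes "strong_hankel_tensor m n h A"
  obtains \<alpha> \<gamma> :: "nat \<Rightarrow> real" where "\<And>j. 0 \<le> \<alpha> j"
    "\<And>I. I \<in> multi_indices m n \<Longrightarrow>
      A I = (\<Sum>j=1..(n - 1) * m + 1. \<alpha> j * \<gamma> j ^ (sum_list I - m))"
proof -
  define N where "N = (n - 1) * m"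
  obtain v where h: "\<And>t. 0 \<le> h t" and A: "A = hankel_tensor m n v"
    and v: "\<And>k. k \<le> N \<Longrightarrow> integrable lebesgue (\<lambda>t. t ^ k * h t)"
      "\<And>k. k \<le> N \<Longrightarrow> v k = integral\<^sup>L lebesgue (\<lambda>t. t ^ k * h t)"
    using assms by (auto simp: strong_hankel_tensor_def N_def)
  obtain Z w where Z: "finite Z" "card Z = Suc (N div 2)" "\<And>x. x \<in> Z \<Longrightarrow> 0 \<le> w x"
    and vZ: "\<And>k. k \<le> N \<Longrightarrow> v k = (\<Sum>x\<in>Z. w x * x ^ k)"
    using moments_finitely_atomic[OF h v] by blast
  obtain \<gamma> where \<gamma>: "bij_betw \<gamma> {1..card Z} Z"
    using ex_bij_betw_nat_finite_1[OF Z(1)] by blast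
  define \<alpha> where "\<alpha> j = (if j \<in> {1..card Z} then w (\<gamma> j) else 0)" for j
  show thesis
  proof
    show "0 \<le> \<alpha> j" for j
      using Z(3) bij_betwE[OF \<gamma>] by (auto simp: \<alpha>_def)
  next
    fix I assume I: "I \<in> multi_indices m n"
    let ?k = "sum_list I - m"
    have k: "?k \<le> N" using hankel_index_le[OF I] by (simp add: N_def)
    have "A I = v ?k" using I by (simp add: A hankel_tensor_def)
    also have "\<dots> = (\<Sum>x\<in>Z. w x * x ^ ?k)" using vZ k by blast
    also have "\<dots> = (\<Sum>j\<in>{1..card Z}. w (\<gamma> j) * \<gamma> j ^ ?k)"
      by (rule sum.reindex_bij_betw[OF \<gamma>, symmetric])
    also have "\<dots> = (\<Sum>j\<in>{1..card Z}. \<alpha> j * \<gamma> j ^ ?k)"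
      by (intro sum.cong) (auto simp: \<alpha>_def)
    also have "\<dots> = (\<Sum>j=1..N + 1. \<alpha> j * \<gamma> j ^ ?k)"
      using Z(2) by (intro sum.mono_neutral_left) (auto simp: \<alpha>_def)
    finally show "A I = (\<Sum>j=1..(n - 1) * m + 1. \<alpha> j * \<gamma> j ^ ?k)" by (simp add: N_def)
  qed
qed

theorem theorem3:
  fixes m n :: nat and h :: "real \<Rightarrow> real" and A :: "nat list \<Rightarrow> real"
  assumes "m \<ge> 1" and "n \<ge> 1"
    and "strong_hankel_tensor m n h A"
  shows "(even m \<longrightarrow> completely_decomposable m n A \<and>
            (\<exists>B. (\<forall>k. complete_hankel_tensor m n (B k)) \<and> tensor_tendsto m n B A)) \<and>
         (odd m \<longrightarrow> completely_r_decomposable m n ((n - 1) * m + 1) A)"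
proof -
  define r where "r = (n - 1) * m + 1"
  obtain \<alpha> \<gamma> :: "nat \<Rightarrow> real" where \<alpha>: "\<And>j. 0 \<le> \<alpha> j"
    and AI: "\<And>I. I \<in> multi_indices m n \<Longrightarrow> A I = (\<Sum>j=1..r. \<alpha> j * \<gamma> j ^ (sum_list I - m))"
    using strong_hankel_tensor_decomposition[OF assms(3)] unfolding r_def by blast
  obtain v where v: "A = hankel_tensor m n v"
    using assms(3) by (auto simp: strong_hankel_tensor_def)
  have A_ext: "A = (\<lambda>I\<in>multi_indices m n. F I)"
    if "\<And>I. I \<in> multi_indices m n \<Longrightarrow> A I = F I" for F
    using that by (auto simp: v hankel_tensor_def fun_eq_iff)
  have "tensor_power m n (\<lambda>i. root m (\<alpha> j) * \<gamma> j ^ (i - 1)) I = \<alpha> j * \<gamma> j ^ (sum_list I - m)"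
    if "I \<in> multi_indices m n" for I j
    using tensor_power_geometric[OF that] \<alpha> assms(1) by simp
  hence "A = (\<lambda>I\<in>multi_indices m n. \<Sum>j=1..r.
            tensor_power m n (\<lambda>i. root m (\<alpha> j) * \<gamma> j ^ (i - 1)) I)"
    by (intro A_ext) (simp add: AI)
  moreover have "A \<in> symmetric_tensors m n" unfolding v by (rule hankel_tensor_symmetric)
  ultimately have dec: "completely_r_decomposable m n r A"
    unfolding completely_r_decomposable_def
    by (intro conjI exI[of _ "\<lambda>j i. root m (\<alpha> j) * \<gamma> j ^ (i - 1)"])
  have "complete_hankel_tensor m n A"
    unfolding complete_hankel_tensor_def
  proof (intro exI conjI ballI)
    show "1 \<le> r" by (simp add: r_def)
    show "0 \<le> \<alpha> j" for j by (rule \<alpha>)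
    show "vandermonde_vector n (\<lambda>i. \<gamma> j ^ (i - 1))" for j
      by (auto simp: vandermonde_vector_def)
    show "A = (\<lambda>I\<in>multi_indices m n. \<Sum>j=1..r. \<alpha> j * tensor_power m n (\<lambda>i. \<gamma> j ^ (i - 1)) I)"
      using tensor_power_geometric[of _ m n 1] by (intro A_ext) (simp add: AI)
  qed
  moreover have "tensor_tendsto m n (\<lambda>_. A) A" by (simp add: tensor_tendsto_def)
  moreover have "completely_decomposable m n A"
    using dec unfolding completely_decomposable_def r_def by (intro exI[of _ "(n - 1) * m + 1"]) simp
  ultimately show ?thesis using dec unfolding r_def by (intro conjI impI exI[of _ "\<lambda>_. A"]) auto
qed

end
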